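(* Let $(S,\mathcal{A},\mu)$ be a complete, $\sigma$-finite measure space. If $X$ is a generalised lush (GL) real Banach space, then $L^1(\mu,X)$ is also GL.
   Context: For a real Banach space $X$, $y^*\in S_{X^*}$ and $\varepsilon>0$, $S(y^*,\varepsilon)=\{z\in B_X:y^*(z)>1-\varepsilon\}$, and $d(x,A)=\inf_{a\in A}\|x-a\|$. $X$ is generalised lush (GL) if for every $x\in S_X$ and every $\varepsilon>0$ there is $y^*\in S_{X^*}$ with $x\in S(y^*,\varepsilon)$ and $d(z,S(y^*,\varepsilon))+d(z,-S(y^*,\varepsilon))<2+\varepsilon$ for every $z\in S_X$. $L^1(\mu,X)$ is the Lebesgue–Bochner space. *)

theory Defs
  imports "HOL-Analysis.Analysis"
begin

text \<open>A (semi)normed real vector space given explicitly by a carrier V (closed under the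
operations), addition, scalar multiplication and a (semi)norm N.\<close>

definition dual_sphere ::
  "'v set \<Rightarrow> ('v \<Rightarrow> 'v \<Rightarrow> 'v) \<Rightarrow> (real \<Rightarrow> 'v \<Rightarrow> 'v) \<Rightarrow> ('v \<Rightarrow> real) \<Rightarrow> ('v \<Rightarrow> real) set" where
  "dual_sphere V add scl N =
     {phi. (\<forall>x\<in>V. \<forall>y\<in>V. phi (add x y) = phi x + phi y)
         \<and> (\<forall>c. \<forall>x\<in>V. phi (scl c x) = c * phi x)
         \<and> bdd_above ((\<lambda>z. \<bar>phi z\<bar>) ` {z\<in>V. N z \<le> 1})
         \<and> (SUP z\<in>{z\<in>V. N z \<le> 1}. \<bar>phi z\<bar>) = 1}"

definition slice ::
  "'v set \<Rightarrow> ('v \<Rightarrow> real) \<Rightarrow> ('v \<Rightarrow> real) \<Rightarrow> real \<Rightarrow> 'v set" where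
  "slice V N phi \<epsilon> = {z\<in>V. N z \<le> 1 \<and> phi z > 1 - \<epsilon>}"

definition setdist ::
  "('v \<Rightarrow> 'v \<Rightarrow> 'v) \<Rightarrow> (real \<Rightarrow> 'v \<Rightarrow> 'v) \<Rightarrow> ('v \<Rightarrow> real) \<Rightarrow> 'v \<Rightarrow> 'v set \<Rightarrow> real" where
  "setdist add scl N x A = (INF a\<in>A. N (add x (scl (-1) a)))"

definition GL_space ::
  "'v set \<Rightarrow> ('v \<Rightarrow> 'v \<Rightarrow> 'v) \<Rightarrow> (real \<Rightarrow> 'v \<Rightarrow> 'v) \<Rightarrow> ('v \<Rightarrow> real) \<Rightarrow> bool" where
  "GL_space V add scl N \<longleftrightarrow>
     (\<forall>x\<in>V. N x = 1 \<longrightarrow> (\<forall>\<epsilon>>0. \<exists>phi\<in>dual_sphere V add scl N.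
        x \<in> slice V N phi \<epsilon> \<and>
        (\<forall>z\<in>V. N z = 1 \<longrightarrow>
           setdist add scl N z (slice V N phi \<epsilon>)
           + setdist add scl N z (scl (-1) ` slice V N phi \<epsilon>) < 2 + \<epsilon>)))"

text \<open>Generalised lushness of a real Banach space (a type).\<close>
definition GL :: "'a::banach itself \<Rightarrow> bool" where
  "GL _ \<longleftrightarrow> GL_space (UNIV :: 'a set) (+) (*\<^sub>R) norm"

text \<open>Strongly (mu-)measurable functions: a.e. limits of simple measurable functions.\<close>
definition strongly_measurable :: "'s measure \<Rightarrow> ('s \<Rightarrow> 'b::banach) \<Rightarrow> bool" where
  "strongly_measurable M f \<longleftrightarrow>
     (\<exists>s. (\<forall>i. simple_function M (s i)) \<and> (AE x in M. (\<lambda>i. s i x) \<longlonglongrightarrow> f x))"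

text \<open>Lebesgue--Bochner space L1(mu,X), represented by its Bochner integrable functions
with the L1 seminorm (vectors differing on a null set have distance 0).\<close>
definition L1 :: "'s measure \<Rightarrow> ('s \<Rightarrow> 'b::banach) set" where
  "L1 M = {f. strongly_measurable M f \<and> (\<integral>\<^sup>+x. ennreal (norm (f x)) \<partial>M) < \<infinity>}"

definition L1norm :: "'s measure \<Rightarrow> ('s \<Rightarrow> 'b::banach) \<Rightarrow> real" where
  "L1norm M f = enn2real (\<integral>\<^sup>+x. ennreal (norm (f x)) \<partial>M)"

definition fadd :: "('s \<Rightarrow> 'b::real_vector) \<Rightarrow> ('s \<Rightarrow> 'b) \<Rightarrow> 's \<Rightarrow> 'b" where
  "fadd f g = (\<lambda>x. f x + g x)"

definition fscale :: "real \<Rightarrow> ('s \<Rightarrow> 'b::real_vector) \<Rightarrow> 's \<Rightarrow> 'b" where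
  "fscale c f = (\<lambda>x. c *\<^sub>R f x)"

end

theory Submission
  imports Defs
begin

text \<open>Approximate the unit vector \<open>x\<close> of \<open>L\<^sup>1(\<mu>, X)\<close> by a unit simple function \<open>u\<close>. For every value
  \<open>v\<close> of \<open>u\<close> choose a functional \<open>Y v\<close> on \<open>X\<close> witnessing the GL property at \<open>v / \<parallel>v\<parallel>\<close>; integrating
  against \<open>s \<mapsto> Y (u s)\<close> gives a norm-one functional \<open>\<phi>\<close> on \<open>L\<^sup>1(\<mu>, X)\<close> with \<open>\<phi> x\<close> close to 1.
  Given a unit vector \<open>z\<close>, approximate it by a unit simple function \<open>w\<close> and apply the GL property of
  \<open>Y (u s)\<close> at \<open>w s\<close> for each \<open>s\<close>: this produces simple functions \<open>g\<close>, \<open>h\<close> in the slice of \<open>\<phi>\<close> with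
  \<open>\<parallel>z - g\<parallel> + \<parallel>z + h\<parallel>\<close> close to \<open>2 + \<epsilon>\<close>.\<close>

lemma (in complete_measure) borel_measurable_AE_cong:
  assumes "f \<in> borel_measurable M" and "AE x in M. f x = g x"
  shows "g \<in> borel_measurable M"
proof (rule borel_measurableI)
  fix S :: "'b set" assume "open S"
  have "AE x in M. x \<in> f -` S \<inter> space M \<longleftrightarrow> x \<in> g -` S \<inter> space M"
    using assms(2) by eventually_elim auto
  moreover have "f -` S \<inter> space M \<in> sets M"
    using assms(1) \<open>open S\<close> by (simp add: measurable_sets borel_open)
  ultimately show "g -` S \<inter> space M \<in> sets M"
    by (rule in_sets_AE) auto
qed

lemma (in complete_measure) borel_measurable_AE_LIMSEQ:
  fixes f :: "'a \<Rightarrow> 'b::metric_space"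
  assumes "\<And>i. g i \<in> borel_measurable M" and "AE x in M. (\<lambda>i. g i x) \<longlonglongrightarrow> f x"
  shows "f \<in> borel_measurable M"
proof -
  obtain N where N: "N \<in> null_sets M" "{x\<in>space M. \<not> (\<lambda>i. g i x) \<longlonglongrightarrow> f x} \<subseteq> N"
    using assms(2) unfolding eventually_ae_filter by blast
  define f' where "f' x = (if x \<in> N then f undefined else f x)" for x
  define g' where "g' i x = (if x \<in> N then f undefined else g i x)" for i x
  have "g' i \<in> borel_measurable M" for i
    unfolding g'_def using assms(1) N(1) by (intro measurable_If_set) auto
  moreover have "(\<lambda>i. g' i x) \<longlonglongrightarrow> f' x" if "x \<in> space M" for x
    using N(2) that by (cases "x \<in> N") (auto simp: g'_def f'_def)
  ultimately have "f' \<in> borel_measurable M"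
    by (rule borel_measurable_LIMSEQ_metric)
  moreover have "AE x in M. f' x = f x"
    using AE_not_in[OF N(1)] by eventually_elim (simp add: f'_def)
  ultimately show ?thesis
    by (rule borel_measurable_AE_cong)
qed

lemma strongly_measurable_simple_function:
  "simple_function M f \<Longrightarrow> strongly_measurable M f"
  unfolding strongly_measurable_def by (intro exI[of _ "\<lambda>i. f"]) auto

lemma (in complete_measure) strongly_measurable_imp_borel_measurable:
  assumes "strongly_measurable M f"
  shows "f \<in> borel_measurable M"
proof -
  obtain s where "\<And>i. simple_function M (s i)" "AE x in M. (\<lambda>i. s i x) \<longlonglongrightarrow> f x"
    using assms unfolding strongly_measurable_def by blast
  then show ?thesis
    by (blast intro: borel_measurable_AE_LIMSEQ[of s] borel_measurable_simple_function)
qed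

lemma strongly_measurable_compose2:
  fixes f :: "'s \<Rightarrow> 'b::banach" and g :: "'s \<Rightarrow> 'c::banach"
  assumes "strongly_measurable M f" "strongly_measurable M g"
    and F: "\<And>X Y a b. X \<longlonglongrightarrow> a \<Longrightarrow> Y \<longlonglongrightarrow> b \<Longrightarrow> (\<lambda>i. F (X i) (Y i)) \<longlonglongrightarrow> F a b"
  shows "strongly_measurable M (\<lambda>x. F (f x) (g x) :: 'd::banach)"
proof -
  obtain s where s: "\<And>i. simple_function M (s i)" "AE x in M. (\<lambda>i. s i x) \<longlonglongrightarrow> f x"
    using assms(1) unfolding strongly_measurable_def by blast
  obtain t where t: "\<And>i. simple_function M (t i)" "AE x in M. (\<lambda>i. t i x) \<longlonglongrightarrow> g x"
    using assms(2) unfolding strongly_measurable_def by blast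
  have "AE x in M. (\<lambda>i. F (s i x) (t i x)) \<longlonglongrightarrow> F (f x) (g x)"
    using s(2) t(2) by eventually_elim (rule F)
  moreover have "simple_function M (\<lambda>x. F (s i x) (t i x))" for i
    using s(1) t(1) by (rule simple_function_compose2)
  ultimately show ?thesis
    unfolding strongly_measurable_def by (intro exI[of _ "\<lambda>i x. F (s i x) (t i x)"]) simp
qed

lemma strongly_measurable_compose_simple:
  fixes f :: "'s \<Rightarrow> 'b::banach"
  assumes "simple_function M u" "strongly_measurable M f"
    and F: "\<And>a X b. X \<longlonglongrightarrow> b \<Longrightarrow> (\<lambda>i. F a (X i)) \<longlonglongrightarrow> F a b"
  shows "strongly_measurable M (\<lambda>x. F (u x) (f x) :: 'd::banach)"
proof -
  obtain s where s: "\<And>i. simple_function M (s i)" "AE x in M. (\<lambda>i. s i x) \<longlonglongrightarrow> f x"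
    using assms(2) unfolding strongly_measurable_def by blast
  have "AE x in M. (\<lambda>i. F (u x) (s i x)) \<longlonglongrightarrow> F (u x) (f x)"
    using s(2) by eventually_elim (rule F)
  moreover have "simple_function M (\<lambda>x. F (u x) (s i x))" for i
    using assms(1) s(1) by (rule simple_function_compose2)
  ultimately show ?thesis
    unfolding strongly_measurable_def by (intro exI[of _ "\<lambda>i x. F (u x) (s i x)"]) simp
qed

lemma L1norm_nonneg: "0 \<le> L1norm M f"
  by (simp add: L1norm_def)

lemma L1norm_mono:
  assumes "f \<in> L1 M" and "\<And>x. x \<in> space M \<Longrightarrow> norm (g x) \<le> norm (f x)"
  shows "L1norm M g \<le> L1norm M f"
  unfolding L1norm_def
proof (rule enn2real_mono)
  show "(\<integral>\<^sup>+x. ennreal (norm (g x)) \<partial>M) \<le> (\<integral>\<^sup>+x. ennreal (norm (f x)) \<partial>M)"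
    using assms(2) by (intro nn_integral_mono ennreal_leI)
qed (use assms(1) in \<open>simp add: L1_def\<close>)

lemma L1norm_diff_commute: "L1norm M (\<lambda>x. f x - g x) = L1norm M (\<lambda>x. g x - f x)"
  by (simp add: L1norm_def norm_minus_commute)

lemma simple_function_in_L1:
  "simple_function M f \<Longrightarrow> (\<integral>\<^sup>+x. ennreal (norm (f x)) \<partial>M) < \<infinity> \<Longrightarrow> f \<in> L1 M"
  unfolding L1_def by (simp add: strongly_measurable_simple_function)

context complete_measure
begin

lemma L1_integrable_norm:
  assumes "f \<in> L1 M"
  shows "integrable M (\<lambda>x. norm (f x))"
proof -
  have "strongly_measurable M (\<lambda>x. norm (f x))"
    using assms unfolding L1_def
    by (auto intro: strongly_measurable_compose2[where F="\<lambda>a b. norm a"] tendsto_norm)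
  then show ?thesis
    using assms strongly_measurable_imp_borel_measurable
    by (simp add: integrable_iff_bounded L1_def)
qed

lemma L1norm_eq_integral:
  assumes "f \<in> L1 M"
  shows "L1norm M f = (\<integral>x. norm (f x) \<partial>M)"
  unfolding L1norm_def
  by (subst nn_integral_eq_integral[OF L1_integrable_norm[OF assms]]) auto

lemma L1_dominated:
  assumes "strongly_measurable M f" and "integrable M h"
    and "\<And>x. x \<in> space M \<Longrightarrow> norm (f x) \<le> h x"
  shows "f \<in> L1 M"
proof -
  have "(\<integral>\<^sup>+x. ennreal (norm (f x)) \<partial>M) \<le> (\<integral>\<^sup>+x. ennreal (h x) \<partial>M)"
    using assms(3) by (intro nn_integral_mono ennreal_leI)
  also have "\<dots> = ennreal (\<integral>x. h x \<partial>M)"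
    using assms(2,3) by (intro nn_integral_eq_integral AE_I2) (auto intro: order_trans[OF norm_ge_zero])
  finally show ?thesis
    using assms(1) unfolding L1_def by (auto simp: top.not_eq_extremum order_le_less_trans)
qed

lemma L1_add_scaleR:
  assumes "f \<in> L1 M" and "g \<in> L1 M"
  shows "(\<lambda>x. f x + c *\<^sub>R g x) \<in> L1 M"
proof (rule L1_dominated)
  show "strongly_measurable M (\<lambda>x. f x + c *\<^sub>R g x)"
    using assms unfolding L1_def
    by (auto intro!: strongly_measurable_compose2[where F="\<lambda>a b. a + c *\<^sub>R b"] tendsto_intros)
  show "integrable M (\<lambda>x. norm (f x) + \<bar>c\<bar> * norm (g x))"
    using assms by (intro Bochner_Integration.integrable_add integrable_mult_right L1_integrable_norm)
  show "norm (f x + c *\<^sub>R g x) \<le> norm (f x) + \<bar>c\<bar> * norm (g x)" for x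
    using norm_triangle_ineq[of "f x" "c *\<^sub>R g x"] by simp
qed

lemma L1_add: "f \<in> L1 M \<Longrightarrow> g \<in> L1 M \<Longrightarrow> (\<lambda>x. f x + g x) \<in> L1 M"
  using L1_add_scaleR[of f g 1] by simp

lemma L1_diff: "f \<in> L1 M \<Longrightarrow> g \<in> L1 M \<Longrightarrow> (\<lambda>x. f x - g x) \<in> L1 M"
  using L1_add_scaleR[of f g "-1"] by simp

lemma L1_scaleR: "f \<in> L1 M \<Longrightarrow> (\<lambda>x. c *\<^sub>R f x) \<in> L1 M"
  using L1_add_scaleR[of f f "c - 1"] by (simp add: scaleR_diff_left)

lemma L1norm_triangle:
  assumes "f \<in> L1 M" and "g \<in> L1 M"
  shows "L1norm M (\<lambda>x. f x + g x) \<le> L1norm M f + L1norm M g"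
proof -
  have "(\<integral>x. norm (f x + g x) \<partial>M) \<le> (\<integral>x. norm (f x) + norm (g x) \<partial>M)"
    using assms by (intro integral_mono L1_integrable_norm L1_add Bochner_Integration.integrable_add)
      (auto intro: norm_triangle_ineq)
  then show ?thesis
    using assms by (simp add: L1norm_eq_integral L1_add L1_integrable_norm)
qed

lemma L1norm_diff_triangle:
  assumes "f \<in> L1 M" and "g \<in> L1 M" and "h \<in> L1 M"
  shows "L1norm M (\<lambda>x. f x - h x) \<le> L1norm M (\<lambda>x. f x - g x) + L1norm M (\<lambda>x. g x - h x)"
  using L1norm_triangle[OF L1_diff[OF assms(1,2)] L1_diff[OF assms(2,3)]] by simp

lemma abs_L1norm_diff_le:
  assumes "f \<in> L1 M" and "g \<in> L1 M"
  shows "\<bar>L1norm M f - L1norm M g\<bar> \<le> L1norm M (\<lambda>x. f x - g x)"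
proof -
  have "L1norm M f \<le> L1norm M (\<lambda>x. f x - g x) + L1norm M g"
    using L1norm_triangle[OF L1_diff[OF assms] assms(2)] by simp
  moreover have "L1norm M g \<le> L1norm M (\<lambda>x. g x - f x) + L1norm M f"
    using L1norm_triangle[OF L1_diff[OF assms(2,1)] assms(1)] by simp
  ultimately show ?thesis
    using L1norm_diff_commute[of M f g] by linarith
qed

lemma L1norm_scaleR:
  assumes "f \<in> L1 M"
  shows "L1norm M (\<lambda>x. c *\<^sub>R f x) = \<bar>c\<bar> * L1norm M f"
  using assms by (simp add: L1norm_eq_integral L1_scaleR)

lemma L1_dominated_simple_approx:
  assumes "f \<in> L1 M"
  obtains t where "\<And>i. simple_function M (t i)" "\<And>i. t i \<in> L1 M"
    "\<And>i x. norm (t i x) \<le> 2 * norm (f x)" "AE x in M. (\<lambda>i. t i x) \<longlonglongrightarrow> f x"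
proof -
  obtain s where s: "\<And>i. simple_function M (s i)" "AE x in M. (\<lambda>i. s i x) \<longlonglongrightarrow> f x"
    using assms unfolding L1_def strongly_measurable_def by blast
  have [measurable]: "(\<lambda>x. norm (f x)) \<in> borel_measurable M"
    using L1_integrable_norm[OF assms] by auto
  have [measurable]: "(\<lambda>x. norm (s i x)) \<in> borel_measurable M" for i
    using borel_measurable_simple_function[OF s(1)] by measurable
  \<comment> \<open>truncation keeps the approximants dominated by \<open>2 \<bar>f\<bar>\<close>, as dominated convergence needs\<close>
  define A where "A i = {x\<in>space M. norm (s i x) \<le> 2 * norm (f x)}" for i
  have [measurable]: "A i \<in> sets M" for i
    unfolding A_def by measurable
  define t where "t i x = indicator (A i) x *\<^sub>R s i x" for i x
  have t_simple: "simple_function M (t i)" for i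
    unfolding t_def using s(1) by (intro simple_function_compose2[where h="(*\<^sub>R)"]) auto
  have t_bound: "norm (t i x) \<le> 2 * norm (f x)" for i x
    by (auto simp: t_def A_def indicator_def)
  have "t i \<in> L1 M" for i
    using t_bound L1_integrable_norm[OF assms]
    by (intro L1_dominated[where h="\<lambda>x. 2 * norm (f x)"] strongly_measurable_simple_function t_simple)
      auto
  moreover have "AE x in M. (\<lambda>i. t i x) \<longlonglongrightarrow> f x"
    using AE_space s(2)
  proof eventually_elim
    case (elim x)
    show ?case
    proof (cases "f x = 0")
      case True
      then show ?thesis
        using t_bound[of _ x] by simp
    next
      case False
      then have "\<forall>\<^sub>F i in sequentially. norm (s i x) < 2 * norm (f x)"
        using order_tendstoD(2)[OF tendsto_norm[OF elim(2)]] by simp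
      then have "\<forall>\<^sub>F i in sequentially. t i x = s i x"
        by eventually_elim (use elim(1) in \<open>simp add: t_def A_def\<close>)
      then show ?thesis
        using elim(2) by (rule iffD2[OF tendsto_cong])
    qed
  qed
  ultimately show ?thesis
    using that t_simple t_bound by blast
qed

lemma L1_simple_approx:
  assumes "f \<in> L1 M" and "\<delta> > 0"
  obtains w where "simple_function M w" "w \<in> L1 M" "L1norm M (\<lambda>x. f x - w x) < \<delta>"
proof -
  obtain t where t: "\<And>i. simple_function M (t i)" "\<And>i. t i \<in> L1 M"
    "\<And>i x. norm (t i x) \<le> 2 * norm (f x)" "AE x in M. (\<lambda>i. t i x) \<longlonglongrightarrow> f x"
    using L1_dominated_simple_approx[OF assms(1)] by blast
  have "(\<lambda>i. \<integral>x. norm (f x - t i x) \<partial>M) \<longlonglongrightarrow> (\<integral>x. 0 \<partial>M)"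
  proof (rule integral_dominated_convergence[where w="\<lambda>x. 3 * norm (f x)"])
    show "(\<lambda>x. norm (f x - t i x)) \<in> borel_measurable M" for i
      using L1_integrable_norm[OF L1_diff[OF assms(1) t(2)]] by auto
    show "integrable M (\<lambda>x. 3 * norm (f x))"
      using L1_integrable_norm[OF assms(1)] by simp
    show "AE x in M. (\<lambda>i. norm (f x - t i x)) \<longlonglongrightarrow> 0"
      using t(4) by eventually_elim (simp add: norm_minus_commute[of "f _"] tendsto_norm_zero_iff LIM_zero_iff)
    show "AE x in M. norm (norm (f x - t i x)) \<le> 3 * norm (f x)" for i
    proof (rule AE_I2)
      show "norm (norm (f x - t i x)) \<le> 3 * norm (f x)" for x
        using norm_triangle_ineq4[of "f x" "t i x"] t(3)[of i x] by simp
    qed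
  qed simp
  then have "\<forall>\<^sub>F i in sequentially. (\<integral>x. norm (f x - t i x) \<partial>M) < \<delta>"
    using assms(2) by (auto dest: order_tendstoD(2))
  then obtain i where "(\<integral>x. norm (f x - t i x) \<partial>M) < \<delta>"
    using eventually_happens'[OF sequentially_bot] by blast
  then show ?thesis
    using that[of "t i"] t(1,2) assms(1) by (simp add: L1norm_eq_integral L1_diff)
qed

lemma L1_simple_approx_norm_eq:
  assumes "f \<in> L1 M" and "L1norm M f > 0" and "\<delta> > 0"
  obtains w where "simple_function M w" "w \<in> L1 M" "L1norm M w = L1norm M f"
    "L1norm M (\<lambda>x. f x - w x) < \<delta>"
proof -
  obtain w0 where w0: "simple_function M w0" "w0 \<in> L1 M"
    "L1norm M (\<lambda>x. f x - w0 x) < min (\<delta> / 2) (L1norm M f)"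
    using L1_simple_approx[OF assms(1), of "min (\<delta> / 2) (L1norm M f)"] assms(2,3) by auto
  have close: "\<bar>L1norm M w0 - L1norm M f\<bar> < min (\<delta> / 2) (L1norm M f)"
    using abs_L1norm_diff_le[OF assms(1) w0(2)] w0(3) by linarith
  \<comment> \<open>rescale \<open>w0\<close> to the norm of \<open>f\<close>; this moves it by \<open>\<bar>L1norm M w0 - L1norm M f\<bar>\<close>\<close>
  define c where "c = L1norm M f / L1norm M w0"
  have c: "\<bar>1 - c\<bar> * L1norm M w0 = \<bar>L1norm M w0 - L1norm M f\<bar>" "\<bar>c\<bar> * L1norm M w0 = L1norm M f"
    using close assms(2) by (auto simp: c_def field_simps abs_mult[symmetric] abs_minus_commute)
  define w where "w = (\<lambda>x. c *\<^sub>R w0 x)"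
  have w: "simple_function M w" "w \<in> L1 M"
    using w0(1,2) by (auto simp: w_def L1_scaleR intro: simple_function_compose2[where h="(*\<^sub>R)"])
  have "L1norm M (\<lambda>x. w0 x - w x) = \<bar>1 - c\<bar> * L1norm M w0"
    using L1norm_scaleR[OF w0(2), of "1 - c"] by (simp add: w_def scaleR_diff_left)
  then have "L1norm M (\<lambda>x. f x - w x) < \<delta>"
    using L1norm_diff_triangle[OF assms(1) w0(2) w(2)] w0(3) close c(1) by linarith
  moreover have "L1norm M w = L1norm M f"
    using L1norm_scaleR[OF w0(2)] c(2) by (simp add: w_def)
  ultimately show ?thesis
    using that w by blast
qed

end

lemma dual_sphere_linear:
  fixes phi :: "'b::real_normed_vector \<Rightarrow> real"
  assumes "phi \<in> dual_sphere UNIV (+) (*\<^sub>R) norm"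
  shows "phi (x + y) = phi x + phi y" and "phi (c *\<^sub>R x) = c * phi x"
  using assms unfolding dual_sphere_def by auto

lemma dual_sphere_abs_le_norm:
  fixes phi :: "'b::real_normed_vector \<Rightarrow> real"
  assumes "phi \<in> dual_sphere UNIV (+) (*\<^sub>R) norm"
  shows "\<bar>phi z\<bar> \<le> norm z"
proof (cases "z = 0")
  case True
  then show ?thesis
    using dual_sphere_linear(2)[OF assms, of 0 0] by simp
next
  case False
  have "\<bar>phi (inverse (norm z) *\<^sub>R z)\<bar> \<le> (SUP y\<in>{y. norm y \<le> 1}. \<bar>phi y\<bar>)"
    using assms False unfolding dual_sphere_def by (intro cSUP_upper) auto
  then have "\<bar>phi z\<bar> / norm z \<le> 1"
    using assms False unfolding dual_sphere_def by (simp add: abs_mult divide_inverse_commute)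
  then show ?thesis
    using False by (simp add: divide_le_eq)
qed

lemma dual_sphere_bounded_linear:
  fixes phi :: "'b::real_normed_vector \<Rightarrow> real"
  assumes "phi \<in> dual_sphere UNIV (+) (*\<^sub>R) norm"
  shows "bounded_linear phi"
  using dual_sphere_linear[OF assms] dual_sphere_abs_le_norm[OF assms]
  by (intro bounded_linear_intro[where K=1]) (auto simp: abs_le_iff)

text \<open>A functional witnessing generalised lushness at every vector at once, in homogeneous form:
  \<open>a\<close> and \<open>-b\<close> are the points of the slice and of its reflection close to \<open>p\<close>, scaled by \<open>norm p\<close>.\<close>
definition GL_witness :: "('b::real_normed_vector \<Rightarrow> real) \<Rightarrow> real \<Rightarrow> bool" where
  "GL_witness phi e \<longleftrightarrow> phi \<in> dual_sphere UNIV (+) (*\<^sub>R) norm \<and>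
     (\<forall>p. \<exists>a b. norm a \<le> norm p \<and> norm b \<le> norm p
        \<and> (1 - e) * norm p \<le> phi a \<and> (1 - e) * norm p \<le> phi b
        \<and> norm (p - a) + norm (p + b) \<le> (2 + e) * norm p)"

lemma GL_witnessI:
  fixes phi :: "'b::real_normed_vector \<Rightarrow> real"
  assumes phi: "phi \<in> dual_sphere UNIV (+) (*\<^sub>R) norm"
    and unit: "\<And>q. norm q = 1 \<Longrightarrow> \<exists>a b. norm a \<le> 1 \<and> norm b \<le> 1 \<and> 1 - e < phi a \<and> 1 - e < phi b
        \<and> norm (q - a) + norm (q + b) < 2 + e"
  shows "GL_witness phi e"
  unfolding GL_witness_def
proof (intro conjI allI phi)
  fix p :: 'b
  show "\<exists>a b. norm a \<le> norm p \<and> norm b \<le> norm p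
        \<and> (1 - e) * norm p \<le> phi a \<and> (1 - e) * norm p \<le> phi b
        \<and> norm (p - a) + norm (p + b) \<le> (2 + e) * norm p"
  proof (cases "p = 0")
    case True
    then show ?thesis
      using dual_sphere_linear(2)[OF phi, of 0 0] by (intro exI[of _ 0]) simp
  next
    case False
    then obtain a b where ab: "norm a \<le> 1" "norm b \<le> 1" "1 - e < phi a" "1 - e < phi b"
      "norm (p /\<^sub>R norm p - a) + norm (p /\<^sub>R norm p + b) < 2 + e"
      using unit[of "p /\<^sub>R norm p"] by auto
    have "p - norm p *\<^sub>R a = norm p *\<^sub>R (p /\<^sub>R norm p - a)"
      and "p + norm p *\<^sub>R b = norm p *\<^sub>R (p /\<^sub>R norm p + b)"
      using False by (simp_all add: algebra_simps)
    then have "norm (p - norm p *\<^sub>R a) + norm (p + norm p *\<^sub>R b)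
        = norm p * (norm (p /\<^sub>R norm p - a) + norm (p /\<^sub>R norm p + b))"
      by (simp add: distrib_left)
    also have "\<dots> \<le> (2 + e) * norm p"
      using ab(5) by (simp add: mult.commute mult_left_mono)
    finally have "norm (p - norm p *\<^sub>R a) + norm (p + norm p *\<^sub>R b) \<le> (2 + e) * norm p" .
    moreover have "norm (norm p *\<^sub>R a) \<le> norm p" "norm (norm p *\<^sub>R b) \<le> norm p"
      using ab(1,2) by (simp_all add: mult_left_le)
    moreover have "(1 - e) * norm p \<le> phi (norm p *\<^sub>R a)" "(1 - e) * norm p \<le> phi (norm p *\<^sub>R b)"
      using ab(3,4) by (simp_all add: dual_sphere_linear(2)[OF phi] mult.commute mult_left_mono)
    ultimately show ?thesis
      by blast
  qed
qed

lemma setdist_lessD: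
  assumes "setdist add scl N z A < r" and "A \<noteq> {}"
  obtains a where "a \<in> A" "N (add z (scl (-1) a)) < r"
  using assms cInf_lessD[of "(\<lambda>a. N (add z (scl (-1) a))) ` A" r] unfolding setdist_def by auto

lemma GL_witness_exists:
  fixes p :: "'b::banach"
  assumes "GL TYPE('b)" and "norm p = 1" and "e > 0"
  obtains phi where "GL_witness phi e" "1 - e < phi p"
proof -
  let ?S = "\<lambda>phi. slice UNIV norm phi e"
  obtain phi where phi: "phi \<in> dual_sphere UNIV (+) (*\<^sub>R) norm" and p: "p \<in> ?S phi"
    and near: "\<And>q. norm q = 1 \<Longrightarrow> setdist (+) (*\<^sub>R) norm q (?S phi)
        + setdist (+) (*\<^sub>R) norm q ((*\<^sub>R) (-1) ` ?S phi) < 2 + e"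
    using assms unfolding GL_def GL_space_def by blast
  have "GL_witness phi e"
  proof (rule GL_witnessI[OF phi])
    fix q :: 'b assume "norm q = 1"
    define d1 where "d1 = setdist (+) (*\<^sub>R) norm q (?S phi)"
    define d2 where "d2 = setdist (+) (*\<^sub>R) norm q ((*\<^sub>R) (-1) ` ?S phi)"
    define \<eta> where "\<eta> = (2 + e - d1 - d2) / 2"
    have "0 < \<eta>"
      using near[OF \<open>norm q = 1\<close>] by (simp add: \<eta>_def d1_def d2_def)
    have S: "?S phi \<noteq> {}" "(*\<^sub>R) (-1) ` ?S phi \<noteq> {}"
      using p by blast+
    have "setdist (+) (*\<^sub>R) norm q (?S phi) < d1 + \<eta>"
      using \<open>0 < \<eta>\<close> by (simp add: d1_def)
    then obtain a where a: "a \<in> ?S phi" "norm (q + (-1) *\<^sub>R a) < d1 + \<eta>"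
      using S(1) by (rule setdist_lessD)
    have "setdist (+) (*\<^sub>R) norm q ((*\<^sub>R) (-1) ` ?S phi) < d2 + \<eta>"
      using \<open>0 < \<eta>\<close> by (simp add: d2_def)
    then obtain b' where b': "b' \<in> (*\<^sub>R) (-1) ` ?S phi" "norm (q + (-1) *\<^sub>R b') < d2 + \<eta>"
      using S(2) by (rule setdist_lessD)
    then obtain b where b: "b \<in> ?S phi" "norm (q + b) < d2 + \<eta>"
      by auto
    show "\<exists>a b. norm a \<le> 1 \<and> norm b \<le> 1 \<and> 1 - e < phi a \<and> 1 - e < phi b
        \<and> norm (q - a) + norm (q + b) < 2 + e"
    proof (intro exI conjI)
      show "norm a \<le> 1" "norm b \<le> 1" "1 - e < phi a" "1 - e < phi b"
        using a(1) b(1) by (simp_all add: slice_def)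
      have "d1 + d2 + 2 * \<eta> = 2 + e"
        by (simp add: \<eta>_def field_simps)
      then show "norm (q - a) + norm (q + b) < 2 + e"
        using a(2) b(2) by simp
    qed
  qed
  then show ?thesis
    using that p by (simp add: slice_def)
qed

lemma GL_witness_family:
  assumes "GL TYPE('b)" and "e > 0" and "\<exists>p::'b. p \<noteq> 0"
  obtains Y :: "'b::banach \<Rightarrow> 'b \<Rightarrow> real" where "\<And>v. GL_witness (Y v) e" "\<And>v. (1 - e) * norm v \<le> Y v v"
proof -
  have "\<exists>phi. GL_witness phi e \<and> (1 - e) * norm v \<le> phi v" for v :: 'b
  proof (cases "v = 0")
    case True
    obtain p :: 'b where "p \<noteq> 0"
      using assms(3) by blast
    obtain phi where "GL_witness phi e" "1 - e < phi (p /\<^sub>R norm p)"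
      by (rule GL_witness_exists[where p="p /\<^sub>R norm p", OF assms(1) _ assms(2)])
        (use \<open>p \<noteq> 0\<close> in simp)
    moreover have "phi v = 0"
      using \<open>GL_witness phi e\<close> True dual_sphere_linear(2)[of phi 0 0]
      by (simp add: GL_witness_def)
    ultimately show ?thesis
      using True by auto
  next
    case False
    obtain phi where phi: "GL_witness phi e" "1 - e < phi (v /\<^sub>R norm v)"
      by (rule GL_witness_exists[where p="v /\<^sub>R norm v", OF assms(1) _ assms(2)])
        (use False in simp)
    have "phi v = norm v * phi (v /\<^sub>R norm v)"
      using phi(1) False dual_sphere_linear(2)[of phi "norm v" "v /\<^sub>R norm v"]
      by (simp add: GL_witness_def)
    then have "(1 - e) * norm v \<le> phi v"
      using phi(2) by (simp add: mult.commute mult_left_mono)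
    then show ?thesis
      using phi(1) by blast
  qed
  then obtain Y where "\<And>v::'b. GL_witness (Y v) e \<and> (1 - e) * norm v \<le> Y v v"
    by metis
  then show ?thesis
    using that by blast
qed

lemma setdist_le_L1norm:
  "g \<in> A \<Longrightarrow> setdist fadd fscale (L1norm M) z A \<le> L1norm M (\<lambda>x. z x - g x)"
  unfolding setdist_def
  by (rule cINF_lower2[where x=g]) (auto intro: bdd_belowI2[where m=0] L1norm_nonneg simp: fadd_def fscale_def)

lemma setdist_reflect_le_L1norm:
  "h \<in> A \<Longrightarrow> setdist fadd fscale (L1norm M) z (fscale (-1) ` A) \<le> L1norm M (\<lambda>x. z x + h x)"
  using setdist_le_L1norm[of "fscale (-1) h" "fscale (-1) ` A" M z] by (simp add: fscale_def)

lemma simple_function_level_set_pos: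
  fixes u :: "'s \<Rightarrow> 'b::banach"
  assumes u: "simple_function M u" and "u \<in> L1 M" and "L1norm M u \<noteq> 0"
  obtains v where "0 < measure M {s\<in>space M. u s = v}"
proof (rule ccontr)
  assume none: "\<not> thesis"
  define C where "C v = {s\<in>space M. u s = v}" for v
  have C: "C v \<in> sets M" for v
    using simple_functionD(2)[OF u, of "{v}"] by (simp add: C_def vimage_def Int_def conj_commute)
  have no_pos: "\<not> 0 < measure M (C v)" for v
    using none that unfolding C_def by blast
  have "C v \<in> null_sets M" if "v \<noteq> 0" for v
  proof -
    have "ennreal (norm v) * emeasure M (C v) = (\<integral>\<^sup>+s. ennreal (norm v) * indicator (C v) s \<partial>M)"
      using C by (simp add: nn_integral_cmult_indicator)
    also have "\<dots> \<le> (\<integral>\<^sup>+s. ennreal (norm (u s)) \<partial>M)"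
      by (intro nn_integral_mono) (auto simp: C_def indicator_def)
    also have "\<dots> < \<infinity>"
      using assms(2) by (simp add: L1_def)
    finally have "emeasure M (C v) < \<infinity>"
      using that by (auto simp: ennreal_mult_less_top)
    moreover have "\<not> 0 < measure M (C v)"
      using no_pos by blast
    ultimately show ?thesis
      using C measure_nonneg[of M "C v"] emeasure_eq_ennreal_measure[of M "C v"]
      by (auto simp: null_sets_def)
  qed
  then have "(\<Union>v\<in>u ` space M - {0}. C v) \<in> null_sets M"
    using simple_functionD(1)[OF u] by (intro null_sets_UN') (auto intro: countable_finite)
  moreover have "{s\<in>space M. \<not> norm (u s) = 0} \<subseteq> (\<Union>v\<in>u ` space M - {0}. C v)"
    by (auto simp: C_def)
  ultimately have "AE s in M. norm (u s) = 0"
    by (rule AE_I')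
  then have "(\<integral>\<^sup>+s. ennreal (norm (u s)) \<partial>M) = (\<integral>\<^sup>+s. 0 \<partial>M)"
    by (intro nn_integral_cong_AE) auto
  then have "L1norm M u = 0"
    by (simp add: L1norm_def)
  with assms(3) show False ..
qed

text \<open>Here \<open>s \<mapsto> Y (u s)\<close> is a simple \<open>L\<^sup>\<infinity>(\<mu>, X*)\<close> function acting on \<open>L1 M\<close> by integration;
  functionals of this special form already suffice to exhibit the GL property.\<close>
definition L1_functional :: "'s measure \<Rightarrow> ('c \<Rightarrow> 'b \<Rightarrow> real) \<Rightarrow> ('s \<Rightarrow> 'c) \<Rightarrow> ('s \<Rightarrow> 'b) \<Rightarrow> real" where
  "L1_functional M Y u f = (\<integral>s. Y (u s) (f s) \<partial>M)"

context complete_measure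
begin

lemma integrable_L1_functional:
  fixes f :: "'a \<Rightarrow> 'b::banach"
  assumes "simple_function M u" and Y: "\<And>v. Y v \<in> dual_sphere UNIV (+) (*\<^sub>R) norm"
    and "f \<in> L1 M"
  shows "integrable M (\<lambda>s. Y (u s) (f s))"
proof (rule Bochner_Integration.integrable_bound)
  have "strongly_measurable M f"
    using assms(3) by (simp add: L1_def)
  then have "strongly_measurable M (\<lambda>s. Y (u s) (f s))"
    by (rule strongly_measurable_compose_simple[OF assms(1)])
      (rule bounded_linear.tendsto[OF dual_sphere_bounded_linear[OF Y]])
  then show "(\<lambda>s. Y (u s) (f s)) \<in> borel_measurable M"
    by (rule strongly_measurable_imp_borel_measurable)
  show "integrable M (\<lambda>s. norm (f s))"
    using assms(3) by (rule L1_integrable_norm)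
  show "AE s in M. norm (Y (u s) (f s)) \<le> norm (norm (f s))"
    using dual_sphere_abs_le_norm[OF Y] by simp
qed

lemma abs_L1_functional_le:
  fixes f :: "'a \<Rightarrow> 'b::banach"
  assumes "simple_function M u" and Y: "\<And>v. Y v \<in> dual_sphere UNIV (+) (*\<^sub>R) norm"
    and "f \<in> L1 M"
  shows "\<bar>L1_functional M Y u f\<bar> \<le> L1norm M f"
proof -
  have "\<bar>L1_functional M Y u f\<bar> \<le> (\<integral>s. norm (Y (u s) (f s)) \<partial>M)"
    unfolding L1_functional_def using integral_norm_bound by (metis real_norm_def)
  also have "\<dots> \<le> (\<integral>s. norm (f s) \<partial>M)"
    using assms dual_sphere_abs_le_norm[OF Y]
    by (intro integral_mono integrable_norm integrable_L1_functional L1_integrable_norm) auto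
  finally show ?thesis
    using assms(3) by (simp add: L1norm_eq_integral)
qed

lemma L1_normalized_indicator:
  fixes a :: "'b::banach"
  assumes "C \<in> sets M" and "0 < measure M C"
  defines "f \<equiv> \<lambda>s. (indicator C s / measure M C) *\<^sub>R a"
  shows "f \<in> L1 M" and "L1norm M f = norm a"
proof -
  have "(\<integral>\<^sup>+s. ennreal (norm (f s)) \<partial>M) = (\<integral>\<^sup>+s. ennreal (norm a / measure M C) * indicator C s \<partial>M)"
    by (rule nn_integral_cong) (auto simp: f_def indicator_def)
  also have "\<dots> = ennreal (norm a / measure M C) * emeasure M C"
    using assms(1) by (rule nn_integral_cmult_indicator)
  also have "emeasure M C = ennreal (measure M C)"
    using assms(2) measure_zero_top by (intro emeasure_eq_ennreal_measure) fastforce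
  also have "ennreal (norm a / measure M C) * ennreal (measure M C) = ennreal (norm a)"
    using assms(2) by (simp add: ennreal_mult[symmetric])
  finally have "(\<integral>\<^sup>+s. ennreal (norm (f s)) \<partial>M) = ennreal (norm a)" .
  moreover have "simple_function M f"
    unfolding f_def using assms(1)
    by (intro simple_function_compose2[where h="\<lambda>x y. (x / measure M C) *\<^sub>R y"] simple_function_indicator) auto
  ultimately show "f \<in> L1 M" "L1norm M f = norm a"
    by (simp_all add: simple_function_in_L1 L1norm_def)
qed

lemma L1_functional_in_dual_sphere:
  fixes u :: "'a \<Rightarrow> 'b::banach" and Y :: "'b \<Rightarrow> 'c::banach \<Rightarrow> real"
  assumes u: "simple_function M u" "u \<in> L1 M" "L1norm M u \<noteq> 0"
    and Y: "\<And>v. Y v \<in> dual_sphere UNIV (+) (*\<^sub>R) norm"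
  shows "L1_functional M Y u \<in> dual_sphere (L1 M) fadd fscale (L1norm M)"
proof -
  let ?\<phi> = "L1_functional M Y u"
  define B where "B = {f \<in> L1 M. L1norm M (f :: 'a \<Rightarrow> 'c) \<le> 1}"
  obtain v where pos: "0 < measure M {s\<in>space M. u s = v}"
    using simple_function_level_set_pos[OF u] .
  define C where "C = {s\<in>space M. u s = v}"
  have C: "C \<in> sets M"
    using simple_functionD(2)[OF u(1), of "{v}"] by (simp add: C_def vimage_def Int_def conj_commute)
  \<comment> \<open>\<open>?\<phi>\<close> restricts to \<open>Y v\<close> on the functions supported by the level set \<open>C\<close>, so its norm is 1\<close>
  define emb where "emb a = (\<lambda>s. (indicator C s / measure M C) *\<^sub>R a)" for a :: 'c
  have emb: "emb a \<in> B" "?\<phi> (emb a) = Y v a" if "norm a \<le> 1" for a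
  proof -
    show "emb a \<in> B"
      using L1_normalized_indicator[OF C pos[folded C_def], where a=a] that by (simp add: B_def emb_def)
    have "?\<phi> (emb a) = (\<integral>s. (Y v a / measure M C) * indicator C s \<partial>M)"
      unfolding L1_functional_def emb_def
      by (rule Bochner_Integration.integral_cong)
        (auto simp: indicator_def C_def dual_sphere_linear(2)[OF Y])
    also have "\<dots> = Y v a"
      using pos C sets.sets_into_space by (simp add: C_def Int_absorb2)
    finally show "?\<phi> (emb a) = Y v a" .
  qed
  have bound: "\<bar>?\<phi> f\<bar> \<le> 1" if "f \<in> B" for f
    using abs_L1_functional_le[where Y=Y, OF u(1) Y] that by (force simp: B_def)
  have "(SUP f\<in>B. \<bar>?\<phi> f\<bar>) \<le> 1"
    using emb(1)[of 0] bound by (intro cSUP_least) auto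
  moreover have "(SUP a\<in>{a::'c. norm a \<le> 1}. \<bar>Y v a\<bar>) \<le> (SUP f\<in>B. \<bar>?\<phi> f\<bar>)"
  proof (rule cSUP_mono)
    show "\<exists>f\<in>B. \<bar>Y v a\<bar> \<le> \<bar>?\<phi> f\<bar>" if "a \<in> {a. norm a \<le> 1}" for a
      using emb that by (intro bexI[of _ "emb a"]) auto
  qed (use bound in \<open>auto intro!: exI[of _ 0] bdd_aboveI2[where M=1]\<close>)
  moreover have "(SUP a\<in>{a::'c. norm a \<le> 1}. \<bar>Y v a\<bar>) = 1"
    using Y[of v] by (simp add: dual_sphere_def)
  moreover have "?\<phi> (fadd f g) = ?\<phi> f + ?\<phi> g" if "f \<in> L1 M" "g \<in> L1 M" for f g
    unfolding L1_functional_def fadd_def dual_sphere_linear(1)[OF Y]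
    using that by (intro Bochner_Integration.integral_add integrable_L1_functional[where Y=Y, OF u(1) Y])
  moreover have "?\<phi> (fscale c f) = c * ?\<phi> f" for c f
    by (simp add: L1_functional_def fscale_def dual_sphere_linear(2)[OF Y])
  ultimately show ?thesis
    using bound unfolding dual_sphere_def B_def by (auto intro!: bdd_aboveI2[where M=1])
qed

lemma L1_functional_lower_bound:
  fixes u :: "'a \<Rightarrow> 'b::banach"
  assumes u: "simple_function M u" "u \<in> L1 M"
    and Y: "\<And>v. Y v \<in> dual_sphere UNIV (+) (*\<^sub>R) norm" "\<And>v. c * norm v \<le> Y v v"
    and f: "f \<in> L1 M"
  shows "c * L1norm M u - L1norm M (\<lambda>s. f s - u s) \<le> L1_functional M Y u f"
proof -
  have "c * norm (u s) - norm (f s - u s) \<le> Y (u s) (f s)" for s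
  proof -
    have "Y (u s) (f s) = Y (u s) (u s) + Y (u s) (f s - u s)"
      using dual_sphere_linear(1)[OF Y(1), of "u s" "u s" "f s - u s"] by simp
    then show ?thesis
      using Y(2)[of "u s"] dual_sphere_abs_le_norm[OF Y(1), of "u s" "f s - u s"] by linarith
  qed
  then have "(\<integral>s. c * norm (u s) - norm (f s - u s) \<partial>M) \<le> L1_functional M Y u f"
    unfolding L1_functional_def using u f Y(1)
    by (intro integral_mono integrable_L1_functional Bochner_Integration.integrable_diff
        integrable_mult_right L1_integrable_norm L1_diff) auto
  then show ?thesis
    using u f by (simp add: L1norm_eq_integral L1_diff L1_integrable_norm)
qed

lemma L1_functional_GL_pair:
  fixes u :: "'a \<Rightarrow> 'b::banach" and w :: "'a \<Rightarrow> 'c::banach"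
  assumes u: "simple_function M u" and Y: "\<And>v. GL_witness (Y v) e"
    and w: "simple_function M w" "w \<in> L1 M"
  obtains g h where "g \<in> L1 M" "h \<in> L1 M" "L1norm M g \<le> L1norm M w" "L1norm M h \<le> L1norm M w"
    "(1 - e) * L1norm M w \<le> L1_functional M Y u g" "(1 - e) * L1norm M w \<le> L1_functional M Y u h"
    "L1norm M (\<lambda>s. w s - g s) + L1norm M (\<lambda>s. w s + h s) \<le> (2 + e) * L1norm M w"
proof -
  have Yd: "\<And>v. Y v \<in> dual_sphere UNIV (+) (*\<^sub>R) norm"
    using Y by (simp add: GL_witness_def)
  define good where "good v p a b \<longleftrightarrow> norm a \<le> norm p \<and> norm b \<le> norm p
     \<and> (1 - e) * norm p \<le> Y v a \<and> (1 - e) * norm p \<le> Y v b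
     \<and> norm (p - a) + norm (p + b) \<le> (2 + e) * norm p" for v p a b
  have "\<forall>vp. \<exists>ab. good (fst vp) (snd vp) (fst ab) (snd ab)"
    using Y by (simp add: GL_witness_def good_def)
  then obtain F where F: "\<forall>vp. good (fst vp) (snd vp) (fst (F vp)) (snd (F vp))"
    by (rule choice[THEN exE])
  \<comment> \<open>the witnesses are chosen without regard to measurability,
    but \<open>g\<close> and \<open>h\<close> are simple because \<open>u\<close> and \<open>w\<close> are\<close>
  define g where "g = (\<lambda>s. fst (F (u s, w s)))"
  define h where "h = (\<lambda>s. snd (F (u s, w s)))"
  have gh: "good (u s) (w s) (g s) (h s)" for s
    using F by (simp add: g_def h_def)
  have "simple_function M g" "simple_function M h"
    unfolding g_def h_def by (rule simple_function_compose2[OF u w(1)])+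
  then have L1: "g \<in> L1 M" "h \<in> L1 M"
    using gh L1_integrable_norm[OF w(2)]
    by (auto intro!: L1_dominated[where h="\<lambda>s. norm (w s)"] strongly_measurable_simple_function
        simp: good_def)
  have "(\<integral>s. (1 - e) * norm (w s) \<partial>M) \<le> L1_functional M Y u g"
    "(\<integral>s. (1 - e) * norm (w s) \<partial>M) \<le> L1_functional M Y u h"
    unfolding L1_functional_def using gh L1
    by (intro integral_mono integrable_mult_right L1_integrable_norm[OF w(2)]
        integrable_L1_functional[where Y=Y, OF u Yd]; force simp: good_def)+
  moreover have "(\<integral>s. norm (w s - g s) + norm (w s + h s) \<partial>M) \<le> (\<integral>s. (2 + e) * norm (w s) \<partial>M)"
    using w L1 gh unfolding good_def
    by (intro integral_mono Bochner_Integration.integrable_add L1_integrable_norm L1_diff L1_add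
        integrable_mult_right) auto
  moreover have "L1norm M g \<le> L1norm M w" "L1norm M h \<le> L1norm M w"
    using w(2) gh by (auto intro!: L1norm_mono simp: good_def)
  ultimately show ?thesis
    using that L1 w by (simp add: L1norm_eq_integral L1_diff L1_add L1_integrable_norm)
qed

lemma L1_functional_GL_setdist:
  fixes u :: "'a \<Rightarrow> 'b::banach" and z :: "'a \<Rightarrow> 'c::banach"
  assumes u: "simple_function M u" and Y: "\<And>v. GL_witness (Y v) e" and "e < \<epsilon>"
    and z: "z \<in> L1 M" "L1norm M z = 1"
  defines "S \<equiv> slice (L1 M) (L1norm M) (L1_functional M Y u) \<epsilon>"
  shows "setdist fadd fscale (L1norm M) z S + setdist fadd fscale (L1norm M) z (fscale (-1) ` S)
    \<le> 2 + e"
proof (rule field_le_epsilon)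
  fix \<delta> :: real assume "0 < \<delta>"
  then obtain w where w: "simple_function M w" "w \<in> L1 M" "L1norm M w = 1"
    "L1norm M (\<lambda>s. z s - w s) < \<delta> / 2"
    using L1_simple_approx_norm_eq[OF z(1), of "\<delta> / 2"] z(2) by auto
  obtain g h where gh: "g \<in> L1 M" "h \<in> L1 M" "L1norm M g \<le> 1" "L1norm M h \<le> 1"
    "1 - e \<le> L1_functional M Y u g" "1 - e \<le> L1_functional M Y u h"
    "L1norm M (\<lambda>s. w s - g s) + L1norm M (\<lambda>s. w s + h s) \<le> 2 + e"
    using L1_functional_GL_pair[where Y=Y, OF u Y w(1,2)] w(3) by auto
  have "g \<in> S" "h \<in> S"
    using gh(1-6) \<open>e < \<epsilon>\<close> unfolding S_def slice_def by auto
  have "setdist fadd fscale (L1norm M) z S \<le> L1norm M (\<lambda>s. z s - w s) + L1norm M (\<lambda>s. w s - g s)"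
    using setdist_le_L1norm[OF \<open>g \<in> S\<close>, of M z] L1norm_diff_triangle[OF z(1) w(2) gh(1)]
    by linarith
  moreover have "setdist fadd fscale (L1norm M) z (fscale (-1) ` S)
      \<le> L1norm M (\<lambda>s. z s - w s) + L1norm M (\<lambda>s. w s + h s)"
    using setdist_reflect_le_L1norm[OF \<open>h \<in> S\<close>, of M z]
      L1norm_diff_triangle[OF z(1) w(2) L1_scaleR[OF gh(2), of "-1"]]
    by simp
  ultimately show "setdist fadd fscale (L1norm M) z S + setdist fadd fscale (L1norm M) z (fscale (-1) ` S)
      \<le> 2 + e + \<delta>"
    using gh(7) w(4) by linarith
qed

end

lemma (in complete_measure) L1_norming_functional:
  fixes x :: "'a \<Rightarrow> 'b::banach"
  assumes "GL TYPE('b)" and x: "x \<in> L1 M" "L1norm M x = 1" and "e > 0"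
  obtains Y :: "'b \<Rightarrow> 'b \<Rightarrow> real" and u where "simple_function M u" "\<And>v. GL_witness (Y v) e"
    "L1_functional M Y u \<in> dual_sphere (L1 M) fadd fscale (L1norm M)"
    "1 - 2 * e < L1_functional M Y u x"
proof -
  have "\<exists>p::'b. p \<noteq> 0"
  proof (rule ccontr)
    assume "\<nexists>p::'b. p \<noteq> 0"
    then have "x = (\<lambda>_. 0)"
      by auto
    with x(2) show False
      by (simp add: L1norm_def)
  qed
  then obtain Y :: "'b \<Rightarrow> 'b \<Rightarrow> real" where Y: "\<And>v. GL_witness (Y v) e" "\<And>v. (1 - e) * norm v \<le> Y v v"
    using GL_witness_family[OF assms(1) \<open>e > 0\<close>] by blast
  have Yd: "\<And>v. Y v \<in> dual_sphere UNIV (+) (*\<^sub>R) norm"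
    using Y(1) by (simp add: GL_witness_def)
  obtain u where u: "simple_function M u" "u \<in> L1 M" "L1norm M u = 1" "L1norm M (\<lambda>s. x s - u s) < e"
    using L1_simple_approx_norm_eq[OF x(1) _ \<open>e > 0\<close>] x(2) by auto
  have "L1_functional M Y u \<in> dual_sphere (L1 M) fadd fscale (L1norm M)"
    using L1_functional_in_dual_sphere[where Y=Y, OF u(1,2) _ Yd] u(3) by simp
  moreover have "1 - 2 * e < L1_functional M Y u x"
    using L1_functional_lower_bound[where Y=Y, OF u(1,2) Yd Y(2) x(1)] u(3,4) by simp
  ultimately show ?thesis
    using that u(1) Y(1) by blast
qed

theorem theorem5p1:
  fixes M :: "'s measure"
  assumes "complete_measure M"
    and "sigma_finite_measure M"
    and "GL TYPE('b::banach)"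
  shows "GL_space (L1 M :: ('s \<Rightarrow> 'b) set) fadd fscale (L1norm M)"
  unfolding GL_space_def
proof (intro ballI impI allI)
  interpret complete_measure M by fact
  fix x :: "'s \<Rightarrow> 'b" and \<epsilon> :: real
  assume x: "x \<in> L1 M" "L1norm M x = 1" and "\<epsilon> > 0"
  define e where "e = \<epsilon> / 2"
  have e: "0 < e" "e < \<epsilon>"
    using \<open>\<epsilon> > 0\<close> by (simp_all add: e_def)
  obtain Y :: "'b \<Rightarrow> 'b \<Rightarrow> real" and u where u: "simple_function M u" "\<And>v. GL_witness (Y v) e"
    and \<phi>: "L1_functional M Y u \<in> dual_sphere (L1 M) fadd fscale (L1norm M)"
      "1 - 2 * e < L1_functional M Y u x"
    using L1_norming_functional[OF assms(3) x e(1)] by blast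
  let ?S = "slice (L1 M) (L1norm M) (L1_functional M Y u) \<epsilon>"
  have "x \<in> ?S"
    using x \<phi>(2) by (simp add: slice_def e_def)
  moreover have "setdist fadd fscale (L1norm M) z ?S + setdist fadd fscale (L1norm M) z (fscale (-1) ` ?S)
      < 2 + \<epsilon>" if "z \<in> L1 M" "L1norm M z = 1" for z
    using L1_functional_GL_setdist[where Y=Y, OF u e(2) that] e(2) by linarith
  ultimately show "\<exists>phi\<in>dual_sphere (L1 M) fadd fscale (L1norm M). x \<in> slice (L1 M) (L1norm M) phi \<epsilon> \<and>
      (\<forall>z\<in>L1 M. L1norm M z = 1 \<longrightarrow>
        setdist fadd fscale (L1norm M) z (slice (L1 M) (L1norm M) phi \<epsilon>)
        + setdist fadd fscale (L1norm M) z (fscale (-1) ` slice (L1 M) (L1norm M) phi \<epsilon>) < 2 + \<epsilon>)"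
    using \<phi>(1) by blast
qed

end
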